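(* Let $X$ be a non-empty topological space. Then $X$ is completely ultrametrizable if and only if there is some strategy $\sigma$ for Alice in $\mathrm{RayGame}(X)$ which always wins at the $\omega$-th inning, i.e. such that every run in which Alice follows $\sigma$ ends at inning $\omega$ and is won by Alice.
   Context: A metric $d$ on $X$ is an ultrametric if $d(x,y)\le\max\{d(x,z),d(z,y)\}$ for all $x,y,z\in X$. A space $X$ is completely ultrametrizable if some ultrametric $d$ induces its topology and $(X,d)$ is complete. The game. A partition of a set is a pairwise disjoint collection of non-empty sets whose union is that set; an open partition is one whose members are open. For a non-empty space $X$, $\mathrm{RayGame}(X)$ is a transfinite game between Alice and Bob. In inning $0$, Alice chooses an open partition $\mathcal P_0$ of $X$ and Bob picks $U_0\in\mathcal P_0$. In a successor inning $\alpha=\beta+1$, Alice chooses an open partition $\mathcal P_{\beta+1}$ of $U_\beta$ and Bob picks $U_{\beta+1}\in\mathcal P_{\beta+1}$. In a (nonzero) limit inning $\alpha$: if there exist a pairwise disjoint collection $\mathcal P_\alpha$ of non-empty open sets and a point $x_\alpha\in X$ such that (1) $\bigcap_{\beta<\alpha}U_\beta=(\bigcup\mathcal P_\alpha)\sqcup\{x_\alpha\}$ (disjoint union) and (2) $\{U_\beta\setminus\bigcup\mathcal F:\beta<\alpha,\ \mathcal F\subset\mathcal P_\alpha\text{ finite}\}$ is a local basis at $x_\alpha$, then Alice chooses one such pair $(\mathcal P_\alpha,x_\alpha)$; if $\mathcal P_\alpha\ne\emptyset$, Bob picks $U_\alpha\in\mathcal P_\alpha$ and the game continues, while if $\mathcal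 P_\alpha=\emptyset$ the run ends and Alice wins. If no such pair exists, the run ends and Bob wins. A strategy for Alice is a map assigning to each sequence $(U_\beta:\beta<\alpha)$ of Bob's moves made against it so far a legal move of Alice in inning $\alpha$ whenever she has one. *)

theory Defs
  imports "HOL-Analysis.Abstract_Metric_Spaces"
begin

definition completely_ultrametrizable_space :: "'a topology \<Rightarrow> bool" where
  "completely_ultrametrizable_space X \<longleftrightarrow>
     (\<exists>M d. Metric_space M d \<and>
        (\<forall>x\<in>M. \<forall>y\<in>M. \<forall>z\<in>M. d x y \<le> max (d x z) (d z y)) \<and>
        Metric_space.mcomplete M d \<and> X = Metric_space.mtopology M d)"

text \<open>
  Innings are ordinals. For a game played on a space with points in \<open>'a\<close>, the ordinals below
  the initial ordinal of the cardinal \<open>2 ^ \<kappa>\<close>, where \<open>\<kappa> = max \<bar>'a\<bar> \<aleph>\<^sub>0\<close>, suffice: whenever a limit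
  inning \<open>\<alpha>\<close> does not end the game, the point \<open>x\<^sub>\<alpha>\<close> is removed for good, so there are at most \<open>\<bar>'a\<bar>\<close>
  such innings and every run ends before the initial ordinal of the successor of \<open>\<kappa>\<close>.
\<close>

typedef 'a inning = "UNIV :: ('a + nat) set set" ..

instantiation inning :: (type) wellorder
begin

definition less_eq_inning :: "'a inning \<Rightarrow> 'a inning \<Rightarrow> bool" where
  "(\<alpha> :: 'a inning) \<le> \<beta> \<longleftrightarrow>
     (Rep_inning \<alpha>, Rep_inning \<beta>) \<in> card_of (UNIV :: ('a + nat) set set)"

definition less_inning :: "'a inning \<Rightarrow> 'a inning \<Rightarrow> bool" where
  "(\<alpha> :: 'a inning) < \<beta> \<longleftrightarrow> \<alpha> \<le> \<beta> \<and> \<alpha> \<noteq> \<beta>"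

instance
proof -
  let ?r = "card_of (UNIV :: ('a + nat) set set)"
  have wo: "well_order_on UNIV ?r"
    by (rule card_of_well_order_on)
  have lin: "linear_order_on UNIV ?r" and wf: "wf (?r - Id)"
    using wo by (auto simp: well_order_on_def)
  have refl: "(a, a) \<in> ?r" for a
    using lin by (auto simp: order_on_defs refl_on_def)
  have tr: "(a, b) \<in> ?r \<Longrightarrow> (b, c) \<in> ?r \<Longrightarrow> (a, c) \<in> ?r" for a b c
    using lin unfolding order_on_defs trans_def by blast
  have anti: "(a, b) \<in> ?r \<Longrightarrow> (b, a) \<in> ?r \<Longrightarrow> a = b" for a b
    using lin unfolding order_on_defs antisym_def by blast
  have tot: "(a, b) \<in> ?r \<or> (b, a) \<in> ?r" for a b
    using lin refl unfolding order_on_defs total_on_def by (cases "a = b") auto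
  show "OFCLASS('a inning, wellorder_class)"
  proof
    fix x y z :: "'a inning"
    show "x < y \<longleftrightarrow> x \<le> y \<and> \<not> y \<le> x"
      using anti[of "Rep_inning x" "Rep_inning y"] refl
      by (auto simp: less_inning_def less_eq_inning_def Rep_inning_inject)
    show "x \<le> x"
      using refl by (simp add: less_eq_inning_def)
    show "x \<le> z" if "x \<le> y" "y \<le> z"
      using that tr by (auto simp: less_eq_inning_def)
    show "x = y" if "x \<le> y" "y \<le> x"
      using that anti[of "Rep_inning x" "Rep_inning y"] by (auto simp: less_eq_inning_def Rep_inning_inject)
    show "x \<le> y \<or> y \<le> x"
      using tot by (simp add: less_eq_inning_def)
  next
    fix P :: "'a inning \<Rightarrow> bool" and a :: "'a inning"
    assume step: "\<And>x. (\<And>y. y < x \<Longrightarrow> P y) \<Longrightarrow> P x"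
    have "wf (inv_image (?r - Id) Rep_inning)"
      using wf by (rule wf_inv_image)
    then show "P a"
    proof (induction a rule: wf_induct_rule)
      case (less x)
      show ?case
        by (rule step, rule less)
          (simp add: less_inning_def less_eq_inning_def Rep_inning_inject)
    qed
  qed
qed

end

definition zero_inning :: "'a inning \<Rightarrow> bool" where
  "zero_inning \<alpha> \<longleftrightarrow> (\<forall>\<beta>. \<not> \<beta> < \<alpha>)"

definition succ_inning :: "'a inning \<Rightarrow> 'a inning \<Rightarrow> bool" where
  "succ_inning \<beta> \<alpha> \<longleftrightarrow> \<beta> < \<alpha> \<and> (\<forall>\<gamma>. \<gamma> < \<alpha> \<longrightarrow> \<gamma> \<le> \<beta>)"

definition limit_inning :: "'a inning \<Rightarrow> bool" where
  "limit_inning \<alpha> \<longleftrightarrow> \<not> zero_inning \<alpha> \<and> (\<nexists>\<beta>. succ_inning \<beta> \<alpha>)"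

definition omega_inning :: "'a inning" where
  "omega_inning = (LEAST \<alpha>. limit_inning \<alpha>)"

lemma limit_inning_omega: "limit_inning (omega_inning :: 'a inning)"
proof -
  have "\<exists>\<alpha> :: 'a inning. infinite {..<\<alpha>}"
  proof (rule ccontr)
    assume "\<not> ?thesis"
    then have fin: "finite {..<\<alpha>}" for \<alpha> :: "'a inning"
      by blast
    define f :: "'a inning \<Rightarrow> nat" where "f = (\<lambda>\<alpha>. card {..<\<alpha>})"
    have "strict_mono f"
      unfolding f_def using fin by (intro strict_monoI psubset_card_mono) auto
    then have "inj f"
      by (rule strict_mono_imp_inj_on)
    define g :: "nat set \<Rightarrow> nat" where "g = (\<lambda>A. f (Abs_inning (Inr ` A)))"
    have "inj g"
    proof (rule injI)
      fix A B assume "g A = g B"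
      then have "(Inr ` A :: ('a + nat) set) = Inr ` B"
        using \<open>inj f\<close> by (simp add: g_def inj_eq Abs_inning_inject)
      then show "A = B"
        by (simp add: inj_image_eq_iff)
    qed
    then have "surj (inv g)"
      by (rule inj_imp_surj_inv)
    then show False
      using Cantors_theorem[of "UNIV :: nat set"] by auto
  qed
  then obtain \<alpha> :: "'a inning"
    where inf: "infinite {..<\<alpha>}" and least: "\<And>\<beta>. \<beta> < \<alpha> \<Longrightarrow> finite {..<\<beta>}"
    using exists_least_iff[of "\<lambda>\<alpha> :: 'a inning. infinite {..<\<alpha>}"] by blast
  have "\<not> zero_inning \<alpha>"
  proof
    assume "zero_inning \<alpha>"
    then have "{..<\<alpha>} = {}"
      by (auto simp: zero_inning_def)
    then show False
      using inf by simp
  qed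
  moreover have "\<not> succ_inning \<beta> \<alpha>" for \<beta>
  proof
    assume "succ_inning \<beta> \<alpha>"
    then have "{..<\<alpha>} \<subseteq> insert \<beta> {..<\<beta>}" and "\<beta> < \<alpha>"
      by (auto simp: succ_inning_def order_le_less)
    then show False
      using inf least by (meson finite_insert finite_subset)
  qed
  ultimately have "limit_inning \<alpha>"
    by (auto simp: limit_inning_def)
  then show ?thesis
    unfolding omega_inning_def by (rule LeastI)
qed

definition open_partition :: "'a topology \<Rightarrow> 'a set \<Rightarrow> 'a set set \<Rightarrow> bool" where
  "open_partition X S P \<longleftrightarrow> partition_on S P \<and> (\<forall>V\<in>P. openin X V)"

definition local_basis_at :: "'a topology \<Rightarrow> 'a \<Rightarrow> 'a set set \<Rightarrow> bool" where
  "local_basis_at X x \<B> \<longleftrightarrow>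
     (\<forall>V\<in>\<B>. openin X V \<and> x \<in> V) \<and>
     (\<forall>W. openin X W \<and> x \<in> W \<longrightarrow> (\<exists>V\<in>\<B>. V \<subseteq> W))"

text \<open>
  A move of Alice is \<open>Split P\<close> at inning zero and at successor innings, and \<open>Ray P x\<close> at limit
  innings.
\<close>

datatype 'a move = Split (pieces: "'a set set") | Ray (pieces: "'a set set") 'a

text \<open>
  The sequence of Bob's moves before inning \<open>\<alpha>\<close> is given by a function \<open>U\<close> on all innings of which
  only the values below \<open>\<alpha>\<close> are used.
\<close>

definition legal_move ::
    "'a topology \<Rightarrow> 'a inning \<Rightarrow> ('a inning \<Rightarrow> 'a set) \<Rightarrow> 'a move \<Rightarrow> bool" where
  "legal_move X \<alpha> U m \<longleftrightarrow>
     (zero_inning \<alpha> \<and> (\<exists>P. m = Split P \<and> open_partition X (topspace X) P)) \<or>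
     (\<exists>\<beta> P. succ_inning \<beta> \<alpha> \<and> m = Split P \<and> open_partition X (U \<beta>) P) \<or>
     (limit_inning \<alpha> \<and>
       (\<exists>P x. m = Ray P x \<and> x \<in> topspace X \<and>
          disjoint P \<and> (\<forall>V\<in>P. V \<noteq> {} \<and> openin X V) \<and>
          (\<Inter>\<beta>\<in>{..<\<alpha>}. U \<beta>) = \<Union>P \<union> {x} \<and> x \<notin> \<Union>P \<and>
          local_basis_at X x {U \<beta> - \<Union>F | \<beta> F. \<beta> < \<alpha> \<and> F \<subseteq> P \<and> finite F}))"

type_synonym 'a strategy = "'a inning \<Rightarrow> ('a inning \<Rightarrow> 'a set) \<Rightarrow> 'a move"

text \<open>Restricting \<open>U\<close> makes the answer depend only on the sequence of Bob's moves before \<open>\<alpha>\<close>.\<close>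

definition answer :: "'a strategy \<Rightarrow> 'a inning \<Rightarrow> ('a inning \<Rightarrow> 'a set) \<Rightarrow> 'a move" where
  "answer \<sigma> \<alpha> U = \<sigma> \<alpha> (restrict U {..<\<alpha>})"

text \<open>
  Bob has made the moves \<open>U \<beta>\<close> for \<open>\<beta> < \<alpha>\<close> against \<open>\<sigma>\<close>, so the game has reached inning \<open>\<alpha>\<close>.
  In particular, it has not ended earlier: Bob cannot pick from an empty collection.
\<close>

definition play :: "'a topology \<Rightarrow> 'a strategy \<Rightarrow> 'a inning \<Rightarrow> ('a inning \<Rightarrow> 'a set) \<Rightarrow> bool" where
  "play X \<sigma> \<alpha> U \<longleftrightarrow>
     (\<forall>\<beta><\<alpha>. legal_move X \<beta> U (answer \<sigma> \<beta> U) \<and> U \<beta> \<in> pieces (answer \<sigma> \<beta> U))"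

definition alice_strategy :: "'a topology \<Rightarrow> 'a strategy \<Rightarrow> bool" where
  "alice_strategy X \<sigma> \<longleftrightarrow>
     (\<forall>\<alpha> U. play X \<sigma> \<alpha> U \<and> (\<exists>m. legal_move X \<alpha> U m) \<longrightarrow> legal_move X \<alpha> U (answer \<sigma> \<alpha> U))"

definition alice_wins_at ::
    "'a topology \<Rightarrow> 'a strategy \<Rightarrow> 'a inning \<Rightarrow> ('a inning \<Rightarrow> 'a set) \<Rightarrow> bool" where
  "alice_wins_at X \<sigma> \<alpha> U \<longleftrightarrow>
     play X \<sigma> \<alpha> U \<and> limit_inning \<alpha> \<and>
     legal_move X \<alpha> U (answer \<sigma> \<alpha> U) \<and> pieces (answer \<sigma> \<alpha> U) = {}"

definition bob_wins_at ::
    "'a topology \<Rightarrow> 'a strategy \<Rightarrow> 'a inning \<Rightarrow> ('a inning \<Rightarrow> 'a set) \<Rightarrow> bool" where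
  "bob_wins_at X \<sigma> \<alpha> U \<longleftrightarrow>
     play X \<sigma> \<alpha> U \<and> limit_inning \<alpha> \<and> (\<nexists>m. legal_move X \<alpha> U m)"

definition run_ends_at ::
    "'a topology \<Rightarrow> 'a strategy \<Rightarrow> 'a inning \<Rightarrow> ('a inning \<Rightarrow> 'a set) \<Rightarrow> bool" where
  "run_ends_at X \<sigma> \<alpha> U \<longleftrightarrow> alice_wins_at X \<sigma> \<alpha> U \<or> bob_wins_at X \<sigma> \<alpha> U"

text \<open>The first conjunct says that every run ends, the second that it does so as required.\<close>

definition always_wins_at :: "'a topology \<Rightarrow> 'a strategy \<Rightarrow> 'a inning \<Rightarrow> bool" where
  "always_wins_at X \<sigma> \<gamma> \<longleftrightarrow>
     (\<nexists>U. \<forall>\<alpha>. play X \<sigma> \<alpha> U) \<and>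
     (\<forall>\<alpha> U. run_ends_at X \<sigma> \<alpha> U \<longrightarrow> \<alpha> = \<gamma> \<and> alice_wins_at X \<sigma> \<alpha> U)"

end

theory Submission imports Defs begin

text \<open>
  A complete ultrametric lets Alice split Bob's move in inning \<open>n\<close> into balls of radius
  \<open>1 / (n + 1)\<close>; by completeness the moves shrink to a single point. Conversely, if Alice wins at
  \<open>\<omega>\<close>, each point \<open>x\<close> determines the run in which Bob always picks the piece containing \<open>x\<close>, and two
  points are close when their runs agree for long. The moves of such a run form a local basis
  at its only common point, which yields the topology, and each branch of the tree of moves is
  itself a run won by Alice, which yields completeness.
\<close>

section \<open>Finite innings\<close>

text \<open>The type of innings carries a well-order but no arithmetic, hence the successor as a
  least larger inning. That a larger one exists is shown below, together with the bound by
  \<omega>.\<close>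

fun finite_inning :: "nat \<Rightarrow> 'a inning" where
  "finite_inning 0 = (LEAST \<alpha>. True)"
| "finite_inning (Suc n) = (LEAST \<alpha>. finite_inning n < \<alpha>)"

lemma zero_inning_iff: "zero_inning \<alpha> \<longleftrightarrow> \<alpha> = finite_inning 0"
proof -
  have least: "finite_inning 0 \<le> \<beta>" for \<beta> :: "'a inning"
    by (simp add: Least_le)
  have "zero_inning (finite_inning 0 :: 'a inning)"
    using least by (auto simp: zero_inning_def not_less simp del: finite_inning.simps)
  moreover have "\<alpha> = finite_inning 0" if "zero_inning \<alpha>"
    using that least[of \<alpha>] by (auto simp: zero_inning_def order_le_less simp del: finite_inning.simps)
  ultimately show ?thesis by blast
qed

lemma succ_inning_unique: "succ_inning \<beta> \<alpha> \<Longrightarrow> succ_inning \<gamma> \<alpha> \<Longrightarrow> \<beta> = \<gamma>"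
  by (meson succ_inning_def order_antisym)

lemma not_zero_if_succ: "succ_inning \<beta> \<alpha> \<Longrightarrow> \<not> zero_inning \<alpha>"
  by (auto simp: succ_inning_def zero_inning_def)

text \<open>One induction serves both claims. The limit \<omega> is not the successor of
  \<open>finite_inning n\<close>, so some inning lies strictly between them. It shows that the
  \<open>LEAST\<close> defining the next finite inning is attained, and attained below
  \<omega>.\<close>

lemma finite_inning_less_omega: "finite_inning n < (omega_inning :: 'a inning)"
  and succ_finite_inning: "succ_inning (finite_inning n) (finite_inning (Suc n) :: 'a inning)"
proof -
  let ?w = "omega_inning :: 'a inning"
  have step: "finite_inning (Suc n) < ?w \<and> succ_inning (finite_inning n) (finite_inning (Suc n) :: 'a inning)"
    if less: "finite_inning n < ?w" for n
  proof -
    have "\<not> succ_inning (finite_inning n) ?w"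
      using limit_inning_omega by (auto simp: limit_inning_def)
    then obtain \<gamma> where \<gamma>: "\<gamma> < ?w" "finite_inning n < \<gamma>"
      using less unfolding succ_inning_def by (metis not_le)
    have gt: "finite_inning n < (finite_inning (Suc n) :: 'a inning)"
      using LeastI[of "\<lambda>\<alpha>. finite_inning n < \<alpha>" \<gamma>] \<gamma> by simp
    have le: "finite_inning (Suc n) \<le> \<beta>" if "finite_inning n < \<beta>" for \<beta> :: "'a inning"
      using that by (simp add: Least_le)
    then have "\<beta> \<le> finite_inning n" if "\<beta> < finite_inning (Suc n)" for \<beta> :: "'a inning"
      using that by (meson leD not_le)
    with gt le[OF \<gamma>(2)] \<gamma>(1) show ?thesis
      unfolding succ_inning_def by (meson order_le_less_trans)
  qed
  have less: "finite_inning n < ?w" for n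
  proof (induction n)
    case 0
    show ?case
      using limit_inning_omega[where 'a = 'a] zero_inning_iff[of "?w"]
      by (metis Least_le finite_inning.simps(1) limit_inning_def order_le_neq_trans)
  qed (use step in blast)
  show "finite_inning n < ?w" "succ_inning (finite_inning n) (finite_inning (Suc n) :: 'a inning)"
    using less step by blast+
qed

lemma strict_mono_finite_inning: "strict_mono (finite_inning :: nat \<Rightarrow> 'a inning)"
  using succ_finite_inning unfolding strict_mono_Suc_iff succ_inning_def by blast

lemma finite_inning_less_iff [simp]:
  "(finite_inning m :: 'a inning) < finite_inning n \<longleftrightarrow> m < n"
  by (rule strict_mono_less[OF strict_mono_finite_inning])

lemma finite_inning_eq_iff [simp]:
  "(finite_inning m :: 'a inning) = finite_inning n \<longleftrightarrow> m = n"
  by (rule strict_mono_eq[OF strict_mono_finite_inning])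

declare finite_inning.simps [simp del]

lemma not_limit_if_less_omega: "\<alpha> < omega_inning \<Longrightarrow> \<not> limit_inning \<alpha>"
  unfolding omega_inning_def by (rule not_less_Least)

lemma not_limit_finite_inning [simp]: "\<not> limit_inning (finite_inning n)"
  by (simp add: finite_inning_less_omega not_limit_if_less_omega)

text \<open>Below \<omega> there are no limits, so well-founded induction meets only zero and
  successors, and the predecessor is finite by induction.\<close>

lemma less_omega_cases:
  assumes "(\<alpha> :: 'a inning) < omega_inning"
  obtains n where "\<alpha> = finite_inning n"
proof -
  have "\<exists>n. \<alpha> = finite_inning n"
    using assms
  proof (induction \<alpha> rule: less_induct)
    case (less \<alpha>)
    show ?case
    proof (cases "zero_inning \<alpha>")
      case True
      then show ?thesis by (auto simp: zero_inning_iff)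
    next
      case False
      then obtain \<beta> where \<beta>: "succ_inning \<beta> \<alpha>"
        using not_limit_if_less_omega[OF less.prems] by (auto simp: limit_inning_def)
      then have "\<beta> < \<alpha>" by (simp add: succ_inning_def)
      then obtain n where n: "\<beta> = finite_inning n"
        using less by (meson order.strict_trans)
      then have "\<alpha> = finite_inning (Suc n)"
        using \<beta> succ_finite_inning[of n, where 'a = 'a]
        unfolding succ_inning_def by (metis leD linorder_neqE)
      then show ?thesis by blast
    qed
  qed
  then show thesis using that by blast
qed

lemma lessThan_omega: "{..<omega_inning} = range (finite_inning :: nat \<Rightarrow> 'a inning)"
  by (auto elim: less_omega_cases simp: finite_inning_less_omega)

lemma less_finite_inning_cases:
  assumes "(\<alpha> :: 'a inning) < finite_inning n"
  obtains m where "m < n" "\<alpha> = finite_inning m"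
proof -
  have "\<alpha> < omega_inning"
    using assms finite_inning_less_omega by (rule order.strict_trans)
  then obtain m where "\<alpha> = finite_inning m" by (rule less_omega_cases)
  then show thesis using assms that by auto
qed

lemma lessThan_finite_inning:
  "{..<finite_inning n :: 'a inning} = finite_inning ` {..<n}"
  by (auto elim: less_finite_inning_cases)

text \<open>Lets a strategy read off the number of the inning; \<open>ball_strategy\<close> takes
  its radius from it.\<close>

lemma card_lessThan_finite_inning [simp]: "card {..<finite_inning n :: 'a inning} = n"
  by (simp add: lessThan_finite_inning card_image inj_on_def)

lemma the_pred_finite_inning [simp]:
  "(THE \<beta>. succ_inning \<beta> (finite_inning (Suc n))) = (finite_inning n :: 'a inning)"
  by (rule the_equality) (use succ_finite_inning succ_inning_unique in blast)+

lemma limit_ge_omega: "limit_inning \<alpha> \<Longrightarrow> omega_inning \<le> \<alpha>"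
  unfolding omega_inning_def by (rule Least_le)

text \<open>Since \<open>play\<close> at \<omega> constrains only the moves before \<omega>, a later
  inning is needed to refute a run through all innings. Without one the type would be countable, yet
  sets of naturals embed into it.\<close>

lemma ex_inning_gt_omega: "\<exists>\<alpha> :: 'a inning. omega_inning < \<alpha>"
proof (rule ccontr)
  assume "\<not> ?thesis"
  then have "(UNIV :: 'a inning set) = insert omega_inning {..<omega_inning}"
    by (auto simp: not_less order_le_less)
  then have "countable (UNIV :: 'a inning set)"
    by (metis lessThan_omega countable_insert countable_image countableI_type)
  then obtain f :: "'a inning \<Rightarrow> nat" where f: "inj f"
    by (auto simp: countable_def)
  define g :: "nat set \<Rightarrow> nat" where "g = (\<lambda>A. f (Abs_inning (Inr ` A)))"
  have "inj g"
  proof (rule injI)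
    fix A B assume "g A = g B"
    then have "(Inr ` A :: ('a + nat) set) = Inr ` B"
      using f by (simp add: g_def inj_eq Abs_inning_inject)
    then show "A = B"
      by (simp add: inj_image_eq_iff)
  qed
  then have "surj (inv g)"
    by (rule inj_imp_surj_inv)
  then show False
    using Cantors_theorem[of "UNIV :: nat set"] by auto
qed

section \<open>Plays\<close>

lemma answer_cong:
  "(\<And>\<beta>. \<beta> < \<alpha> \<Longrightarrow> U \<beta> = V \<beta>) \<Longrightarrow> answer \<sigma> \<alpha> U = answer \<sigma> \<alpha> V"
  unfolding answer_def by (metis restrict_ext lessThan_iff)

lemma legal_move_cong:
  assumes "\<And>\<beta>. \<beta> < \<alpha> \<Longrightarrow> U \<beta> = V \<beta>"
  shows "legal_move X \<alpha> U m \<longleftrightarrow> legal_move X \<alpha> V m"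
proof -
  have "(\<Inter>\<beta>\<in>{..<\<alpha>}. U \<beta>) = (\<Inter>\<beta>\<in>{..<\<alpha>}. V \<beta>)"
    using assms by auto
  moreover have "{U \<beta> - \<Union>F | \<beta> F. \<beta> < \<alpha> \<and> F \<subseteq> P \<and> finite F} =
      {V \<beta> - \<Union>F | \<beta> F. \<beta> < \<alpha> \<and> F \<subseteq> P \<and> finite F}" for P
    using assms by (auto, metis+)
  moreover have "U \<beta> = V \<beta>" if "succ_inning \<beta> \<alpha>" for \<beta>
    using assms that by (simp add: succ_inning_def)
  ultimately show ?thesis
    unfolding legal_move_def by (simp cong: conj_cong)
qed

lemma play_cong:
  assumes "\<And>\<beta>. \<beta> < \<alpha> \<Longrightarrow> U \<beta> = V \<beta>"
  shows "play X \<sigma> \<alpha> U \<longleftrightarrow> play X \<sigma> \<alpha> V"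
proof -
  have "answer \<sigma> \<beta> U = answer \<sigma> \<beta> V" "legal_move X \<beta> U = legal_move X \<beta> V" "U \<beta> = V \<beta>"
    if "\<beta> < \<alpha>" for \<beta>
    using assms that by (auto intro!: answer_cong legal_move_cong ext)
  then show ?thesis
    unfolding play_def by simp
qed

lemma play_mono: "play X \<sigma> \<alpha> U \<Longrightarrow> \<beta> \<le> \<alpha> \<Longrightarrow> play X \<sigma> \<beta> U"
  by (auto simp: play_def)

lemma play_0: "play X \<sigma> (finite_inning 0) U"
proof -
  have "zero_inning (finite_inning 0 :: 'a inning)" by (simp add: zero_inning_iff)
  then show ?thesis by (simp add: play_def zero_inning_def)
qed

lemma play_finite_Suc:
  "play X \<sigma> (finite_inning (Suc n)) U \<longleftrightarrow> play X \<sigma> (finite_inning n) U \<and>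
     legal_move X (finite_inning n) U (answer \<sigma> (finite_inning n) U) \<and>
     U (finite_inning n) \<in> pieces (answer \<sigma> (finite_inning n) U)"
proof -
  have "\<beta> < finite_inning (Suc n) \<longleftrightarrow> \<beta> < finite_inning n \<or> \<beta> = finite_inning n" for \<beta> :: "'a inning"
    using succ_finite_inning[of n, where 'a = 'a] unfolding succ_inning_def
    by (metis order_le_less order.strict_trans)
  then show ?thesis
    unfolding play_def by blast
qed

lemma play_omega_iff: "play X \<sigma> omega_inning U \<longleftrightarrow> (\<forall>n. play X \<sigma> (finite_inning n) U)"
proof
  assume *: "\<forall>n. play X \<sigma> (finite_inning n) U"
  show "play X \<sigma> omega_inning U"
    unfolding play_def
  proof (intro allI impI)
    fix \<beta> :: "'a inning" assume "\<beta> < omega_inning"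
    then obtain n where "\<beta> = finite_inning n" by (rule less_omega_cases)
    then show "legal_move X \<beta> U (answer \<sigma> \<beta> U) \<and> U \<beta> \<in> pieces (answer \<sigma> \<beta> U)"
      using *[rule_format, of "Suc n"] by (simp add: play_finite_Suc)
  qed
next
  assume "play X \<sigma> omega_inning U"
  then show "\<forall>n. play X \<sigma> (finite_inning n) U"
    by (meson play_mono finite_inning_less_omega order_less_imp_le)
qed

section \<open>Legal moves outside limit innings\<close>

lemma legal_pieces:
  assumes "legal_move X \<alpha> U m" "W \<in> pieces m"
  shows "openin X W" "W \<noteq> {}"
  using assms unfolding legal_move_def open_partition_def
  by (auto dest: partition_onD3)

lemma partition_on_ex1:
  assumes "partition_on S P" "x \<in> S"
  shows "\<exists>!W. W \<in> P \<and> x \<in> W"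
proof -
  obtain W where W: "W \<in> P" "x \<in> W"
    using assms by (auto simp: partition_on_def)
  moreover have "V = W" if "V \<in> P" "x \<in> V" for V
    using disjointD[OF partition_onD2[OF assms(1)] that(1) W(1)] that(2) W(2) by blast
  ultimately show ?thesis by blast
qed

lemma open_partition_singleton: "openin X S \<Longrightarrow> S \<noteq> {} \<Longrightarrow> open_partition X S {S}"
  by (simp add: open_partition_def partition_on_def)

text \<open>Alice can always leave the set whole: a previous move of Bob is a piece of a legal move,
  hence open and non-empty, and so forms a one-piece open partition of itself.\<close>

lemma ex_legal_move:
  assumes "topspace X \<noteq> {}" "play X \<sigma> \<alpha> U" "\<not> limit_inning \<alpha>"
  shows "\<exists>m. legal_move X \<alpha> U m"
proof (cases "zero_inning \<alpha>")
  case True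
  then show ?thesis
    using open_partition_singleton[of X "topspace X"] assms(1) by (auto simp: legal_move_def)
next
  case False
  then obtain \<beta> where \<beta>: "succ_inning \<beta> \<alpha>"
    using assms(3) by (auto simp: limit_inning_def)
  then have "openin X (U \<beta>)" "U \<beta> \<noteq> {}"
    using assms(2) legal_pieces unfolding play_def succ_inning_def by blast+
  then have "legal_move X \<alpha> U (Split {U \<beta>})"
    using \<beta> open_partition_singleton[of X "U \<beta>"] by (auto simp: legal_move_def)
  then show ?thesis by blast
qed

text \<open>A partition of a non-empty set has a member, so Bob can be left without a pick only at a
  limit inning.\<close>

lemma legal_pieces_nonempty:
  assumes "topspace X \<noteq> {}" "play X \<sigma> \<alpha> U" "\<not> limit_inning \<alpha>" "legal_move X \<alpha> U m"
  shows "pieces m \<noteq> {}"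
proof -
  consider P where "m = Split P" "open_partition X (topspace X) P"
    | \<beta> P where "succ_inning \<beta> \<alpha>" "m = Split P" "open_partition X (U \<beta>) P"
    using assms(3,4) unfolding legal_move_def by blast
  then show ?thesis
  proof cases
    case 1
    then have "\<Union> (pieces m) = topspace X"
      by (simp add: open_partition_def partition_on_def)
    then show ?thesis
      using assms(1) by (metis Sup_empty)
  next
    case 2
    then have "U \<beta> \<noteq> {}"
      using assms(2) legal_pieces unfolding play_def succ_inning_def by blast
    then show ?thesis
      using 2 by (auto simp: open_partition_def partition_on_def)
  qed
qed

text \<open>Well-founded recursion over innings, where the rule \<open>\<tau>\<close> sees only
  Bob's earlier moves. Both \<open>cut\<close> and \<open>restrict\<close> return
  \<open>undefined\<close> elsewhere, so the equation matches the form of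
  \<open>answer\<close>.\<close>

lemma ex_run_against:
  fixes \<tau> :: "'a inning \<Rightarrow> ('a inning \<Rightarrow> 'a set) \<Rightarrow> 'a set"
  shows "\<exists>V. \<forall>\<alpha>. V \<alpha> = \<tau> \<alpha> (restrict V {..<\<alpha>})"
proof -
  let ?R = "{(\<alpha>, \<beta>). \<alpha> < (\<beta> :: 'a inning)}"
  let ?V = "wfrec ?R (\<lambda>f \<alpha>. \<tau> \<alpha> f)"
  have "?V \<alpha> = \<tau> \<alpha> (cut ?V ?R \<alpha>)" for \<alpha>
    by (rule wfrec[OF wf])
  moreover have "cut ?V ?R \<alpha> = restrict ?V {..<\<alpha>}" for \<alpha>
    by (auto simp: cut_def restrict_def)
  ultimately show ?thesis by metis
qed

section \<open>From a complete ultrametric to a winning strategy\<close>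

locale complete_ultrametric = Metric_space +
  assumes ultra: "\<And>x y z. x \<in> M \<Longrightarrow> y \<in> M \<Longrightarrow> z \<in> M \<Longrightarrow> d x y \<le> max (d x z) (d z y)"
    and complete: mcomplete
begin

section \<open>Partitions into ultrametric balls\<close>

definition balls :: "real \<Rightarrow> 'a set \<Rightarrow> 'a set set" where
  "balls r S = (\<lambda>x. {y \<in> S. d x y < r}) ` S"

text \<open>At finite inning \<open>n\<close> the cardinality is \<open>n\<close>, so the radius is
  \<open>1 / (n + 1)\<close>. At a limit Alice stakes everything on a single point of the
  intersection and offers Bob no pieces.\<close>

definition ball_strategy :: "'a strategy" where
  "ball_strategy \<alpha> U =
     (if limit_inning \<alpha> then Ray {} (SOME x. x \<in> (\<Inter>\<beta>\<in>{..<\<alpha>}. U \<beta>))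
      else Split (balls (inverse (Suc (card {..<\<alpha>})))
        (if zero_inning \<alpha> then M else U (THE \<beta>. succ_inning \<beta> \<alpha>))))"

lemma ultra_less:
  "\<lbrakk>x \<in> M; y \<in> M; z \<in> M; d x z < r; d z y < r\<rbrakk> \<Longrightarrow> d x y < r"
  using ultra[of x y z] by auto

text \<open>Every point of an ultrametric ball is a centre of it.\<close>

lemma ballsD:
  assumes "B \<in> balls r S" "S \<subseteq> M" "u \<in> B"
  shows "B = {y \<in> S. d u y < r}"
proof -
  obtain x where x: "x \<in> S" "B = {y \<in> S. d x y < r}"
    using assms(1) by (auto simp: balls_def)
  have u: "u \<in> S" "d x u < r" using x assms by auto
  have "d x y < r \<longleftrightarrow> d u y < r" if "y \<in> S" for y
    using ultra_less[of x y u r] ultra_less[of u y x r] u x assms(2) that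
    by (auto simp: commute)
  then show ?thesis using x by auto
qed

text \<open>Two balls that share a point \<open>u\<close> are both the ball around \<open>u\<close>,
  hence equal; each point lies in the ball around itself because the radius is positive.\<close>

lemma partition_balls:
  assumes "S \<subseteq> M" "r > 0"
  shows "partition_on S (balls r S)"
proof (rule partition_onI)
  have self: "x \<in> {y \<in> S. d x y < r}" if "x \<in> S" for x
    using that assms by auto
  show "\<Union> (balls r S) = S"
    using self by (auto simp: balls_def)
  show "disjnt B C" if "B \<in> balls r S" "C \<in> balls r S" "B \<noteq> C" for B C
    using that ballsD[OF that(1) assms(1)] ballsD[OF that(2) assms(1)] by (fastforce simp: disjnt_iff)
  show "{} \<notin> balls r S"
    using self by (auto simp: balls_def)
qed

lemma open_partition_balls:
  assumes "openin mtopology S" "r > 0"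
  shows "open_partition mtopology S (balls r S)"
proof -
  have S: "S \<subseteq> M" using assms(1) by (simp add: openin_mtopology)
  have "openin mtopology {y \<in> S. d x y < r}" if "x \<in> S" for x
  proof -
    have "{y \<in> S. d x y < r} = S \<inter> mball x r"
      using S that by (auto simp: mball_def)
    then show ?thesis using assms by auto
  qed
  then show ?thesis
    using partition_balls[OF S assms(2)] by (auto simp: open_partition_def balls_def)
qed

section \<open>Runs against the ball strategy\<close>

lemma answer_0:
  "answer ball_strategy (finite_inning 0) U = Split (balls 1 M)"
  using card_lessThan_finite_inning[of 0, where 'a = 'a]
  by (simp add: answer_def ball_strategy_def zero_inning_iff)

lemma answer_Suc:
  "answer ball_strategy (finite_inning (Suc n)) U =
     Split (balls (inverse (Suc (Suc n))) (U (finite_inning n)))"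
  by (simp add: answer_def ball_strategy_def zero_inning_iff)

lemma legal_finite:
  assumes "play mtopology ball_strategy (finite_inning n) U"
  shows "legal_move mtopology (finite_inning n) U (answer ball_strategy (finite_inning n) U)"
proof (cases n)
  case 0
  then show ?thesis
    using open_partition_balls[of M 1] by (auto simp: legal_move_def answer_0 zero_inning_iff)
next
  case (Suc k)
  then have "openin mtopology (U (finite_inning k))"
    using assms legal_pieces by (simp add: play_finite_Suc) blast
  then have "open_partition mtopology (U (finite_inning k))
      (balls (inverse (real (Suc n))) (U (finite_inning k)))"
    by (intro open_partition_balls) auto
  then show ?thesis
    using Suc succ_finite_inning[of k, where 'a = 'a] unfolding legal_move_def
    by (auto simp: answer_Suc)
qed

text \<open>The last clause says that a move is a ball of the whole space, not merely of the
  preceding move. By induction the larger ball around \<open>u\<close> is the preceding move, so the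
  smaller ball already lies in it and intersecting removes nothing.\<close>

lemma play_balls:
  assumes "play mtopology ball_strategy omega_inning U"
  defines "W \<equiv> \<lambda>n. U (finite_inning n)"
  shows "W n \<subseteq> M" "openin mtopology (W n)" "W n \<noteq> {}" "W (Suc n) \<subseteq> W n"
    and "u \<in> W n \<Longrightarrow> v \<in> M \<Longrightarrow> d u v < inverse (Suc n) \<longleftrightarrow> v \<in> W n"
proof -
  have *: "legal_move mtopology (finite_inning n) U (answer ball_strategy (finite_inning n) U)"
    "W n \<in> pieces (answer ball_strategy (finite_inning n) U)" for n
    using assms(1) play_finite_Suc unfolding play_omega_iff W_def by blast+
  show op: "openin mtopology (W n)" and "W n \<noteq> {}" for n
    using legal_pieces[OF *] by auto
  show sub: "W n \<subseteq> M" for n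
    using op by (simp add: openin_mtopology)
  have W0: "W 0 \<in> balls 1 M" and WSuc: "W (Suc n) \<in> balls (inverse (Suc (Suc n))) (W n)" for n
    using *(2)[of 0] *(2)[of "Suc n"] by (simp_all add: answer_0 answer_Suc W_def)
  show "W (Suc n) \<subseteq> W n" for n
    using WSuc[of n] by (auto simp: balls_def)
  show "d u v < inverse (Suc n) \<longleftrightarrow> v \<in> W n" if "u \<in> W n" "v \<in> M"
    using that
  proof (induction n)
    case 0
    show ?case
      using ballsD[OF W0 subset_refl 0(1)] 0 by auto
  next
    case (Suc n)
    have eq: "W (Suc n) = {y \<in> W n. d u y < inverse (Suc (Suc n))}"
      by (rule ballsD[OF WSuc sub Suc.prems(1)])
    have "u \<in> W n" using Suc.prems(1) eq by blast
    then have IH: "d u v < inverse (Suc n) \<longleftrightarrow> v \<in> W n"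
      using Suc by blast
    have "inverse (real (Suc (Suc n))) < inverse (real (Suc n))"
      by simp
    then have "d u v < inverse (Suc (Suc n)) \<Longrightarrow> v \<in> W n"
      using IH by (meson order.strict_trans)
    then show ?case unfolding eq by blast
  qed
qed

text \<open>Points chosen from the successive moves form a Cauchy sequence, as late terms share a
  small ball. Its limit \<open>z\<close> lies in every move, and the shrinking radii make
  \<open>z\<close> the only common point and the moves a local basis there.\<close>

lemma legal_omega:
  assumes play: "play mtopology ball_strategy omega_inning U"
  shows "legal_move mtopology omega_inning U (answer ball_strategy omega_inning U)"
    and "pieces (answer ball_strategy omega_inning U) = {}"
proof -
  define W where "W n = U (finite_inning n)" for n
  note W = play_balls[OF play, folded W_def]
  let ?I = "\<Inter>\<beta>\<in>{..<omega_inning}. U \<beta>"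
  have I: "?I = (\<Inter>n. W n)"
    by (simp add: lessThan_omega W_def)
  have "decseq W"
    using W(4) by (rule decseq_SucI)
  have small: "\<exists>n. inverse (real (Suc n)) < e" if "e > 0" for e
    using reals_Archimedean[OF that] by blast
  have "\<exists>s. \<forall>n. s n \<in> W n"
    using W(3) by (intro choice) blast
  then obtain s where s: "s n \<in> W n" for n
    by blast
  have sW: "s m \<in> W n" if "n \<le> m" for m n
    using decseqD[OF \<open>decseq W\<close> that] s by blast
  have sM: "s n \<in> M" for n using s W(1) by blast
  have "MCauchy s"
    unfolding MCauchy_def
  proof (intro conjI allI impI)
    show "range s \<subseteq> M" using sM by blast
    fix e :: real assume "e > 0"
    then obtain n where n: "inverse (real (Suc n)) < e" using small by blast
    have "d (s i) (s j) < e" if "n \<le> i" "n \<le> j" for i j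
      using W(5)[OF sW[OF that(1)] sM, of j] sW[OF that(2)] n by linarith
    then show "\<exists>N. \<forall>n n'. N \<le> n \<longrightarrow> N \<le> n' \<longrightarrow> d (s n) (s n') < e" by blast
  qed
  then obtain z where z: "limitin mtopology s z sequentially"
    using complete unfolding mcomplete_def by blast
  then have zM: "z \<in> M" by (simp add: limitin_mspace)
  have zW: "z \<in> W n" for n
  proof -
    have "inverse (real (Suc n)) > 0" by simp
    then obtain N where N: "\<forall>k\<ge>N. d (s k) z < inverse (real (Suc n))"
      using z unfolding limit_metric_sequentially by meson
    \<comment> \<open>The index \<open>max n N\<close> puts the term both into \<open>W n\<close>
      and within the radius of \<open>z\<close>. As every point of \<open>W n\<close> is a centre,
      \<open>z\<close> belongs to \<open>W n\<close> too.\<close>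
    show ?thesis
      using W(5)[OF sW zM, of n "max n N"] N by auto
  qed
  have basis: "\<exists>n. W n \<subseteq> S" if S: "openin mtopology S" "z \<in> S" for S
  proof -
    obtain r where r: "r > 0" "mball z r \<subseteq> S"
      using S by (auto simp: openin_mtopology)
    obtain n where n: "inverse (real (Suc n)) < r" using small[OF r(1)] by blast
    have "W n \<subseteq> mball z r"
    proof
      fix v assume "v \<in> W n"
      then have "v \<in> M" "d z v < inverse (Suc n)"
        using W(1) W(5)[OF zW, of v n] by auto
      then show "v \<in> mball z r" using zM n by simp
    qed
    then show ?thesis using r(2) by blast
  qed
  have "v = z" if "v \<in> (\<Inter>n. W n)" for v
  proof (rule ccontr)
    assume "v \<noteq> z"
    have vM: "v \<in> M" using that W(1) by blast
    then have "d z v > 0" using \<open>v \<noteq> z\<close> zM by auto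
    then obtain n where "inverse (real (Suc n)) < d z v" using small by blast
    then show False using W(5)[OF zW vM, of n] that by auto
  qed
  then have Iz: "?I = {z}" using zW I by auto
  \<comment> \<open>The \<open>SOME\<close> in the strategy has no freedom left, since the
    intersection is a singleton.\<close>
  have ans: "answer ball_strategy omega_inning U = Ray {} z"
    using limit_inning_omega[where 'a = 'a] Iz
    by (simp add: answer_def ball_strategy_def)
  have lb: "local_basis_at mtopology z {U \<beta> - \<Union>F |\<beta> F. \<beta> < omega_inning \<and> F \<subseteq> {} \<and> finite F}"
  proof -
    have "{U \<beta> - \<Union>F |\<beta> F. \<beta> < omega_inning \<and> F \<subseteq> {} \<and> finite F} = U ` {..<omega_inning}"
      by auto
    also have "\<dots> = range W"
      by (auto simp: lessThan_omega W_def)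
    finally show ?thesis
      using zW W(2) basis by (auto simp: local_basis_at_def)
  qed
  show "legal_move mtopology omega_inning U (answer ball_strategy omega_inning U)"
    using limit_inning_omega[where 'a = 'a] lb Iz zM by (simp add: ans legal_move_def)
  show "pieces (answer ball_strategy omega_inning U) = {}"
    by (simp add: ans)
qed

text \<open>A longer play would contain a pick of Bob from the empty collection at \<omega>.\<close>

lemma play_le_omega: "play mtopology ball_strategy \<alpha> U \<Longrightarrow> \<alpha> \<le> omega_inning"
proof (rule ccontr)
  assume play: "play mtopology ball_strategy \<alpha> U" and "\<not> \<alpha> \<le> omega_inning"
  then have "play mtopology ball_strategy omega_inning U"
    "U omega_inning \<in> pieces (answer ball_strategy omega_inning U)"
    by (auto simp: play_def)
  then show False using legal_omega(2) by blast
qed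

lemma ball_strategy_wins:
  "alice_strategy mtopology ball_strategy"
  "always_wins_at mtopology ball_strategy omega_inning"
proof -
  have legal: "legal_move mtopology \<alpha> U (answer ball_strategy \<alpha> U)"
    if play: "play mtopology ball_strategy \<alpha> U" for \<alpha> U
  proof (cases "\<alpha> = omega_inning")
    case True
    then show ?thesis using legal_omega play by blast
  next
    case False
    then have "\<alpha> < omega_inning" using play_le_omega[OF play] by simp
    then obtain n where "\<alpha> = finite_inning n" by (rule less_omega_cases)
    then show ?thesis using legal_finite play by blast
  qed
  then show "alice_strategy mtopology ball_strategy"
    by (auto simp: alice_strategy_def)
  show "always_wins_at mtopology ball_strategy omega_inning"
    unfolding always_wins_at_def
  proof (intro conjI allI impI)
    show "\<nexists>U. \<forall>\<alpha>. play mtopology ball_strategy \<alpha> U"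
      using play_le_omega ex_inning_gt_omega by (meson leD)
  next
    fix \<alpha> U assume "run_ends_at mtopology ball_strategy \<alpha> U"
    then have play: "play mtopology ball_strategy \<alpha> U" and lim: "limit_inning \<alpha>"
      by (auto simp: run_ends_at_def alice_wins_at_def bob_wins_at_def)
    show "\<alpha> = omega_inning"
      using play_le_omega[OF play] limit_ge_omega[OF lim] by simp
    then show "alice_wins_at mtopology ball_strategy \<alpha> U"
      using play lim legal_omega by (simp add: alice_wins_at_def)
  qed
qed

end

section \<open>From a winning strategy to a complete ultrametric\<close>

text \<open>A criterion free of games: \<open>N n x\<close> is the class of \<open>x\<close> at
  level \<open>n\<close> of a tree of successively finer partitions. The distance is
  \<open>1 / (k + 1)\<close> for the first level \<open>k\<close> that separates the points, and
  \<open>branch\<close> supplies completeness.\<close>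

lemma completely_ultrametrizable_if_tree:
  fixes X :: "'a topology" and N :: "nat \<Rightarrow> 'a \<Rightarrow> 'a set"
  defines "M \<equiv> topspace X"
  assumes self: "\<And>n x. x \<in> M \<Longrightarrow> x \<in> N n x"
    and eq: "\<And>n x y. x \<in> M \<Longrightarrow> y \<in> N n x \<Longrightarrow> N n y = N n x"
    and dec: "\<And>n x. x \<in> M \<Longrightarrow> N (Suc n) x \<subseteq> N n x"
    and Int: "\<And>x. x \<in> M \<Longrightarrow> (\<Inter>n. N n x) = {x}"
    and basis: "\<And>x. x \<in> M \<Longrightarrow> local_basis_at X x (range (\<lambda>n. N n x))"
    and branch: "\<And>x :: nat \<Rightarrow> 'a. (\<And>n. x n \<in> M) \<Longrightarrow> (\<And>n. N (Suc n) (x (Suc n)) \<subseteq> N n (x n)) \<Longrightarrow>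
      (\<Inter>n. N n (x n)) \<noteq> {}"
  shows "completely_ultrametrizable_space X"
proof -
  have sub: "N n x \<subseteq> M" if "x \<in> M" for n x
    using basis[OF that] openin_subset[of X "N n x"] by (auto simp: local_basis_at_def M_def)
  have sym: "x \<in> N n y \<longleftrightarrow> y \<in> N n x" if "x \<in> M" "y \<in> M" for x y n
    using that self eq by metis
  have mono: "N n x \<subseteq> N m x" if "x \<in> M" "m \<le> n" for m n x
    using lift_Suc_antimono_le[of "\<lambda>n. N n x"] dec that by blast
  \<comment> \<open>Membership in \<open>M\<close> is built in because \<open>Metric_space\<close>
    demands symmetry for all values of the type; outside \<open>M\<close> the distance defaults to
    0.\<close>
  define sep where "sep = (\<lambda>x y n. x \<in> M \<and> y \<in> M \<and> y \<notin> N n x)"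
  define d :: "'a \<Rightarrow> 'a \<Rightarrow> real" where
    "d = (\<lambda>x y. if \<exists>n. sep x y n then inverse (Suc (LEAST n. sep x y n)) else 0)"
  \<comment> \<open>This equivalence translates between distances and levels. The strict inequality
    matches \<open>n < ?k\<close>: points first separated at level \<open>?k\<close> share a class
    exactly at the levels below it.\<close>
  have d_less: "d x y < inverse (Suc n) \<longleftrightarrow> y \<in> N n x" if "x \<in> M" "y \<in> M" for x y n
  proof (cases "\<exists>n. sep x y n")
    case True
    let ?k = "LEAST n. sep x y n"
    have k: "sep x y ?k" using True by (metis LeastI)
    have "y \<in> N n x \<longleftrightarrow> n < ?k"
    proof
      assume "y \<in> N n x"
      then show "n < ?k"
        using k mono[OF that(1)] unfolding sep_def by (meson not_le subsetD)
    qed (use not_less_Least that in \<open>auto simp: sep_def\<close>)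
    moreover have "d x y < inverse (Suc n) \<longleftrightarrow> n < ?k"
      using True by (simp add: d_def)
    ultimately show ?thesis by simp
  next
    case False
    then show ?thesis using that by (simp add: d_def sep_def)
  qed
  have d_values: "d x y = 0 \<or> (\<exists>n. d x y = inverse (Suc n))" for x y
    by (auto simp: d_def)
  have ultra: "d x y \<le> max (d x z) (d z y)" if "x \<in> M" "y \<in> M" "z \<in> M" for x y z
  proof (rule ccontr)
    assume "\<not> ?thesis"
    then have lt: "d x z < d x y" "d z y < d x y" by auto
    have "d x z \<ge> 0" by (auto simp: d_def)
    \<comment> \<open>The distance exceeds a non-negative number, so it is not 0 and has a level
      \<open>n\<close>. Both other distances are smaller, which puts all three points into one class
      at level \<open>n\<close> and makes \<open>d x y\<close> smaller than itself.\<close>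
    then obtain n where n: "d x y = inverse (Suc n)"
      using d_values[of x y] lt by auto
    then have "z \<in> N n x" "y \<in> N n z"
      using lt d_less that by metis+
    then show False
      using d_less[of x y n] eq[of x z n] n that by simp
  qed
  interpret Metric_space M d
  proof
    show nonneg: "0 \<le> d x y" for x y by (auto simp: d_def)
    have "sep x y n = sep y x n" for x y n
      using sym by (auto simp: sep_def)
    then have "sep x y = sep y x" for x y by blast
    then show "d x y = d y x" for x y by (simp add: d_def)
    show "d x y = 0 \<longleftrightarrow> x = y" if "x \<in> M" "y \<in> M" for x y
    proof
      assume "d x y = 0"
      then have "y \<in> N n x" for n using d_less[of x y n] that by simp
      then have "y \<in> (\<Inter>n. N n x)" by blast
      then show "x = y" using Int[OF that(1)] by simp
    next
      assume "x = y"
      then show "d x y = 0" using self that by (auto simp: d_def sep_def)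
    qed
    show "d x z \<le> d x y + d y z" if "x \<in> M" "y \<in> M" "z \<in> M" for x y z
      using ultra[of x z y] nonneg[of x y] nonneg[of y z] that by linarith
  qed
  \<comment> \<open>Balls of these radii are exactly the classes, so the two topologies can be
    compared through local bases.\<close>
  have ball: "mball x (inverse (Suc n)) = N n x" if "x \<in> M" for x n
  proof (rule set_eqI)
    fix y
    show "y \<in> mball x (inverse (Suc n)) \<longleftrightarrow> y \<in> N n x"
      using d_less[OF that, of y n] sub[OF that, of n] that unfolding in_mball by blast
  qed
  have "openin X S \<longleftrightarrow> openin mtopology S" for S
  proof
    assume S: "openin X S"
    then have "S \<subseteq> M" using openin_subset M_def by blast
    moreover have "\<exists>r>0. mball x r \<subseteq> S" if xS: "x \<in> S" for x
    proof -
      have "x \<in> M" using \<open>S \<subseteq> M\<close> xS by blast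
      then obtain n where "N n x \<subseteq> S"
        using basis S xS unfolding local_basis_at_def by blast
      then show ?thesis
        using ball[OF \<open>x \<in> M\<close>] by (intro exI[of _ "inverse (real (Suc n))"]) simp
    qed
    ultimately show "openin mtopology S" by (simp add: openin_mtopology)
  next
    assume S: "openin mtopology S"
    show "openin X S"
    proof (subst openin_subopen, intro ballI)
      fix x assume "x \<in> S"
      then obtain r where r: "r > 0" "mball x r \<subseteq> S" and x: "x \<in> M"
        using S unfolding openin_mtopology by blast
      obtain n where n: "inverse (real (Suc n)) < r" using reals_Archimedean[OF r(1)] by blast
      then have "N n x \<subseteq> S"
        using ball[OF x, of n] r(2) by (metis mball_subset_concentric order_less_imp_le subset_trans)
      moreover have "openin X (N n x)" "x \<in> N n x"
        using basis[OF x] by (auto simp: local_basis_at_def)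
      ultimately show "\<exists>T. openin X T \<and> x \<in> T \<and> T \<subseteq> S" by blast
    qed
  qed
  then have top: "X = mtopology" by (simp add: topology_eq)
  have mcomplete
    unfolding mcomplete_def
  proof (intro allI impI)
    fix s assume s: "MCauchy s"
    then have sM: "s i \<in> M" for i by (auto simp: MCauchy_def)
    have "\<exists>k. \<forall>i\<ge>k. \<forall>j\<ge>k. s j \<in> N n (s i)" for n
    proof -
      have "inverse (real (Suc n)) > 0" by simp
      then obtain k where "\<forall>i j. k \<le> i \<longrightarrow> k \<le> j \<longrightarrow> d (s i) (s j) < inverse (Suc n)"
        using s unfolding MCauchy_def by meson
      then show ?thesis using d_less sM by blast
    qed
    then obtain k where k: "\<And>n i j. k n \<le> i \<Longrightarrow> k n \<le> j \<Longrightarrow> s j \<in> N n (s i)"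
      by metis
    have "N (Suc n) (s (k (Suc n))) \<subseteq> N n (s (k n))" for n
    proof -
      \<comment> \<open>The indices \<open>k n\<close> need not increase with \<open>n\<close>, so
        both classes are compared through a term that lies beyond both indices.\<close>
      let ?i = "max (k n) (k (Suc n))"
      have "N m (s ?i) = N m (s (k m))" if "m \<in> {n, Suc n}" for m
        using that by (intro eq sM k) auto
      then show ?thesis using dec[OF sM, of n ?i] by simp
    qed
    \<comment> \<open>The classes in which the Cauchy sequence eventually stays form a branch; a
      common point of them is its limit.\<close>
    then have "(\<Inter>n. N n (s (k n))) \<noteq> {}"
      by (rule branch[OF sM])
    then obtain z where z: "z \<in> N n (s (k n))" for n
      by blast
    then have zM: "z \<in> M" using sub[OF sM] by blast
    have "limitin mtopology s z sequentially"
      unfolding limit_metric_sequentially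
    proof (intro conjI allI impI)
      fix e :: real assume "e > 0"
      then obtain n where n: "inverse (real (Suc n)) < e" using reals_Archimedean by blast
      have "d (s i) z < e" if "k n \<le> i" for i
      proof -
        have "N n (s i) = N n (s (k n))"
          using that by (intro eq sM k) auto
        then have "d (s i) z < inverse (Suc n)"
          using d_less[OF sM zM] z by simp
        then show ?thesis using n by linarith
      qed
      then show "\<exists>K. \<forall>n\<ge>K. s n \<in> M \<and> d (s n) z < e" using sM by blast
    qed (rule zM)
    then show "\<exists>x. limitin mtopology s x sequentially" by blast
  qed
  then show ?thesis
    unfolding completely_ultrametrizable_space_def
    using Metric_space_axioms ultra top by blast
qed

section \<open>Runs against a winning strategy\<close>

locale winning_strategy =
  fixes X :: "'a topology" and \<sigma> :: "'a strategy"
  assumes nonempty: "topspace X \<noteq> {}"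
    and strategy: "alice_strategy X \<sigma>"
    and wins: "always_wins_at X \<sigma> omega_inning"
begin

lemma legal_if_not_limit:
  "play X \<sigma> \<alpha> U \<Longrightarrow> \<not> limit_inning \<alpha> \<Longrightarrow> legal_move X \<alpha> U (answer \<sigma> \<alpha> U)"
  using strategy ex_legal_move[OF nonempty] unfolding alice_strategy_def by blast

text \<open>Bob wins no run against \<open>\<sigma>\<close>, so a legal move exists at every limit
  inning reached, and then \<open>alice_strategy\<close> makes the answer legal.\<close>

lemma legal_if_limit:
  assumes "play X \<sigma> \<alpha> U" "limit_inning \<alpha>"
  shows "legal_move X \<alpha> U (answer \<sigma> \<alpha> U)"
proof -
  have "\<not> bob_wins_at X \<sigma> \<alpha> U"
    using wins unfolding always_wins_at_def run_ends_at_def alice_wins_at_def bob_wins_at_def by blast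
  then show ?thesis
    using assms strategy unfolding bob_wins_at_def alice_strategy_def by blast
qed

text \<open>If the run did not end at \<open>\<omega>\<close>, Bob could go on picking arbitrary pieces until it ends later.\<close>

lemma no_pieces_at_omega:
  assumes play: "play X \<sigma> omega_inning U"
  shows "pieces (answer \<sigma> omega_inning U) = {}"
proof (rule ccontr)
  assume nonemp: "pieces (answer \<sigma> omega_inning U) \<noteq> {}"
  \<comment> \<open>The run \<open>V\<close> copies \<open>U\<close> before \<omega> and takes an
    arbitrary piece from then on.\<close>
  obtain V where V: "\<And>\<alpha>. V \<alpha> = (if \<alpha> < omega_inning then U \<alpha>
      else SOME W. W \<in> pieces (\<sigma> \<alpha> (restrict V {..<\<alpha>})))"
    using ex_run_against[of "\<lambda>\<alpha> V. if \<alpha> < omega_inning then U \<alpha> else SOME W. W \<in> pieces (\<sigma> \<alpha> V)"]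
    by auto
  have V1: "V \<alpha> = U \<alpha>" if "\<alpha> < omega_inning" for \<alpha>
    using V[of \<alpha>] that by simp
  have V2: "V \<alpha> \<in> pieces (answer \<sigma> \<alpha> V)" if "\<not> \<alpha> < omega_inning" "pieces (answer \<sigma> \<alpha> V) \<noteq> {}" for \<alpha>
    using V[of \<alpha>] that some_in_eq[of "pieces (answer \<sigma> \<alpha> V)"]
    by (simp add: answer_def some_in_eq)
  have ans: "answer \<sigma> omega_inning V = answer \<sigma> omega_inning U"
    by (rule answer_cong) (rule V1)
  have "play X \<sigma> omega_inning V"
    using play play_cong[of omega_inning V U] V1 by blast
  then have below: "V \<alpha> \<in> pieces (answer \<sigma> \<alpha> V)" if "\<alpha> < omega_inning" for \<alpha>
    using that by (simp add: play_def)
  \<comment> \<open>The run \<open>V\<close> never gets stuck: an empty answer would be a win for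
    Alice, hence occur at \<omega>, where the answer agrees with the one to \<open>U\<close> and is
    non-empty by assumption. So \<open>V\<close> is a run through all innings, which
    \<open>always_wins_at\<close> excludes.\<close>
  have step: "legal_move X \<alpha> V (answer \<sigma> \<alpha> V) \<and> V \<alpha> \<in> pieces (answer \<sigma> \<alpha> V)"
    if pl: "play X \<sigma> \<alpha> V" for \<alpha>
  proof -
    have legal: "legal_move X \<alpha> V (answer \<sigma> \<alpha> V)"
      using legal_if_limit legal_if_not_limit pl by blast
    have "pieces (answer \<sigma> \<alpha> V) \<noteq> {}"
    proof
      assume emp: "pieces (answer \<sigma> \<alpha> V) = {}"
      then have "limit_inning \<alpha>"
        using legal_pieces_nonempty[OF nonempty pl _ legal] by blast
      then have "alice_wins_at X \<sigma> \<alpha> V"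
        using pl legal emp by (simp add: alice_wins_at_def)
      then have "\<alpha> = omega_inning"
        using wins unfolding always_wins_at_def run_ends_at_def by blast
      then show False using emp nonemp ans by simp
    qed
    then show ?thesis using legal below V2 by blast
  qed
  have "play X \<sigma> \<alpha> V" for \<alpha>
  proof (induction \<alpha> rule: less_induct)
    case (less \<alpha>)
    then show ?case using step unfolding play_def by blast
  qed
  then show False
    using wins unfolding always_wins_at_def by blast
qed

text \<open>With no pieces left, only the empty \<open>F\<close> remains in the condition on the
  local basis, which therefore speaks of Bob's moves themselves.\<close>

lemma play_omega_point:
  assumes "play X \<sigma> omega_inning U"
  obtains x where "(\<Inter>n. U (finite_inning n)) = {x}"
    "local_basis_at X x (range (\<lambda>n. U (finite_inning n)))"
proof -
  have lim: "limit_inning (omega_inning :: 'a inning)" by (rule limit_inning_omega)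
  then obtain P x where *: "answer \<sigma> omega_inning U = Ray P x"
      "(\<Inter>\<beta>\<in>{..<omega_inning}. U \<beta>) = \<Union>P \<union> {x}"
      "local_basis_at X x {U \<beta> - \<Union>F | \<beta> F. \<beta> < omega_inning \<and> F \<subseteq> P \<and> finite F}"
    using legal_if_limit[OF assms lim] unfolding legal_move_def limit_inning_def by blast
  then have "P = {}" using no_pieces_at_omega[OF assms] by simp
  then have "{U \<beta> - \<Union>F | \<beta> F. \<beta> < omega_inning \<and> F \<subseteq> P \<and> finite F} = U ` {..<omega_inning}"
    by auto
  then show thesis
    using that[of x] * \<open>P = {}\<close> by (simp add: lessThan_omega image_image)
qed

section \<open>The run determined by a point\<close>

definition run_at :: "'a \<Rightarrow> 'a inning \<Rightarrow> 'a set" where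
  "run_at x = (SOME V. \<forall>\<alpha>. V \<alpha> = (THE W. W \<in> pieces (answer \<sigma> \<alpha> V) \<and> x \<in> W))"

text \<open>Recursion over innings solves the equation by which \<open>run_at\<close> is chosen.
  Only its values at finite innings are used, where the piece containing a point of the space is
  unique.\<close>

lemma run_at_eq: "run_at x \<alpha> = (THE W. W \<in> pieces (answer \<sigma> \<alpha> (run_at x)) \<and> x \<in> W)"
proof -
  have "\<exists>V. \<forall>\<alpha>. V \<alpha> = (THE W. W \<in> pieces (answer \<sigma> \<alpha> V) \<and> x \<in> W)"
    using ex_run_against[of "\<lambda>\<alpha> V. THE W. W \<in> pieces (\<sigma> \<alpha> V) \<and> x \<in> W"]
    unfolding answer_def by blast
  from someI_ex[OF this] show ?thesis
    unfolding run_at_def by blast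
qed

lemma run_at_pieces:
  "\<exists>!W. W \<in> pieces (answer \<sigma> \<alpha> (run_at x)) \<and> x \<in> W \<Longrightarrow>
    run_at x \<alpha> \<in> pieces (answer \<sigma> \<alpha> (run_at x)) \<and> x \<in> run_at x \<alpha>"
  by (drule theI') (simp only: run_at_eq[symmetric])

lemma partition_0:
  "partition_on (topspace X) (pieces (answer \<sigma> (finite_inning 0) U))"
proof -
  have "\<not> succ_inning \<beta> (finite_inning 0)" for \<beta> :: "'a inning"
    using not_zero_if_succ zero_inning_iff by blast
  then show ?thesis
    using legal_if_not_limit[OF play_0, of U] by (auto simp: legal_move_def open_partition_def)
qed

lemma partition_Suc:
  assumes "play X \<sigma> (finite_inning (Suc n)) U"
  shows "partition_on (U (finite_inning n)) (pieces (answer \<sigma> (finite_inning (Suc n)) U))"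
  using legal_if_not_limit[OF assms] succ_inning_unique[OF _ succ_finite_inning[of n, where 'a = 'a]]
  by (auto simp: legal_move_def open_partition_def zero_inning_iff)

text \<open>The clauses need one another: the pick containing \<open>x\<close> extends the play, and
  Alice then partitions that very pick, so exactly one of the new pieces contains
  \<open>x\<close>.\<close>

lemma run_at_unique:
  assumes "x \<in> topspace X"
  shows "play X \<sigma> (finite_inning n) (run_at x) \<and>
    (\<exists>!W. W \<in> pieces (answer \<sigma> (finite_inning n) (run_at x)) \<and> x \<in> W) \<and>
    run_at x (finite_inning n) \<in> pieces (answer \<sigma> (finite_inning n) (run_at x)) \<and>
    x \<in> run_at x (finite_inning n)"
proof (induction n)
  case 0
  have ex1: "\<exists>!W. W \<in> pieces (answer \<sigma> (finite_inning 0) (run_at x)) \<and> x \<in> W"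
    using partition_0 assms by (rule partition_on_ex1)
  with run_at_pieces[OF ex1] play_0 show ?case
    by blast
next
  case (Suc n)
  then have pl: "play X \<sigma> (finite_inning (Suc n)) (run_at x)"
    by (simp add: play_finite_Suc legal_if_not_limit)
  have ex1: "\<exists>!W. W \<in> pieces (answer \<sigma> (finite_inning (Suc n)) (run_at x)) \<and> x \<in> W"
    using partition_Suc[OF pl] Suc by (intro partition_on_ex1) auto
  with pl run_at_pieces[OF ex1] show ?case
    by blast
qed

lemma run_at_play:
  assumes "x \<in> topspace X"
  shows "play X \<sigma> omega_inning (run_at x)"
  using run_at_unique[OF assms] by (simp add: play_omega_iff)

lemma run_at_decreasing:
  assumes "x \<in> topspace X"
  shows "run_at x (finite_inning (Suc n)) \<subseteq> run_at x (finite_inning n)"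
  using run_at_unique[OF assms, of "Suc n"] partition_Suc[of n "run_at x"]
  by (metis Sup_upper partition_onD1)

lemma run_at_subset:
  assumes "x \<in> topspace X"
  shows "run_at x (finite_inning n) \<subseteq> topspace X"
  using run_at_unique[OF assms, of n] legal_pieces(1) legal_if_not_limit openin_subset
  by (metis not_limit_finite_inning)

text \<open>The moves decrease, so \<open>y\<close> also lies in the earlier ones, where the runs
  agree by induction. Hence Alice gives both the same partition, and only one piece contains
  \<open>y\<close>.\<close>

lemma run_at_agree:
  assumes "x \<in> topspace X" "y \<in> run_at x (finite_inning n)"
  shows "run_at y (finite_inning n) = run_at x (finite_inning n)"
  using assms(2)
proof (induction n rule: less_induct)
  case (less n)
  have "run_at x (finite_inning n) \<subseteq> run_at x (finite_inning m)" if "m \<le> n" for m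
    using lift_Suc_antimono_le[of "\<lambda>n. run_at x (finite_inning n)"] run_at_decreasing[OF assms(1)] that
    by blast
  then have "run_at y (finite_inning m) = run_at x (finite_inning m)" if "m < n" for m
    using less that by (meson order_less_imp_le subsetD)
  then have "run_at y \<beta> = run_at x \<beta>" if "\<beta> < finite_inning n" for \<beta>
    using that by (auto elim!: less_finite_inning_cases)
  then have ans: "answer \<sigma> (finite_inning n) (run_at y) = answer \<sigma> (finite_inning n) (run_at x)"
    by (rule answer_cong)
  have y: "y \<in> topspace X"
    using run_at_subset[OF assms(1)] less.prems by blast
  show ?case
    using run_at_unique[OF assms(1), of n] run_at_unique[OF y, of n] less.prems
    unfolding ans by blast
qed

text \<open>The diagonal of the given runs is again a play, because before inning \<open>n\<close>
  it coincides with the run of \<open>x n\<close>. Its outcome at \<omega> provides the common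
  point.\<close>

lemma run_at_branch:
  fixes x :: "nat \<Rightarrow> 'a"
  assumes x: "\<And>n. x n \<in> topspace X"
    and dec: "\<And>n. run_at (x (Suc n)) (finite_inning (Suc n)) \<subseteq> run_at (x n) (finite_inning n)"
  shows "(\<Inter>n. run_at (x n) (finite_inning n)) \<noteq> {}"
proof -
  \<comment> \<open>The inverse of \<open>finite_inning\<close> recovers the number of the inning;
    values at other innings do not affect plays up to \<omega>.\<close>
  define U where "U = (\<lambda>\<alpha> :: 'a inning. run_at (x (inv finite_inning \<alpha>)) \<alpha>)"
  have "inj (finite_inning :: nat \<Rightarrow> 'a inning)" by (auto intro: injI)
  then have U: "U (finite_inning n) = run_at (x n) (finite_inning n)" for n
    by (simp add: U_def)
  have agree: "U (finite_inning m) = run_at (x n) (finite_inning m)" if "m \<le> n" for m n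
  proof -
    have "run_at (x n) (finite_inning n) \<subseteq> run_at (x m) (finite_inning m)"
      using lift_Suc_antimono_le[of "\<lambda>n. run_at (x n) (finite_inning n)"] dec that by blast
    then have "x n \<in> run_at (x m) (finite_inning m)"
      using run_at_unique[OF x] by blast
    then show ?thesis
      using run_at_agree[OF x] U by metis
  qed
  have "play X \<sigma> (finite_inning n) U" for n
  proof -
    have "U \<beta> = run_at (x n) \<beta>" if "\<beta> < finite_inning n" for \<beta>
      using that by (auto elim!: less_finite_inning_cases simp: agree[of _ n])
    then have "play X \<sigma> (finite_inning n) U \<longleftrightarrow> play X \<sigma> (finite_inning n) (run_at (x n))"
      by (rule play_cong)
    then show ?thesis using run_at_unique[OF x] by blast
  qed
  then have "play X \<sigma> omega_inning U" by (simp add: play_omega_iff)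
  then obtain z where "(\<Inter>n. U (finite_inning n)) = {z}"
    by (rule play_omega_point)
  then show ?thesis by (simp add: U)
qed

text \<open>Alice's point at \<omega> is the only common point of the moves, and \<open>x\<close>
  lies in all of them.\<close>

lemma run_at_point:
  assumes "x \<in> topspace X"
  shows "(\<Inter>n. run_at x (finite_inning n)) = {x}"
    and "local_basis_at X x (range (\<lambda>n. run_at x (finite_inning n)))"
proof -
  obtain z where z: "(\<Inter>n. run_at x (finite_inning n)) = {z}"
      "local_basis_at X z (range (\<lambda>n. run_at x (finite_inning n)))"
    using run_at_play[OF assms] by (rule play_omega_point)
  moreover have "x \<in> (\<Inter>n. run_at x (finite_inning n))"
    using run_at_unique[OF assms] by blast
  ultimately have "z = x" by auto
  with z show "(\<Inter>n. run_at x (finite_inning n)) = {x}"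
    "local_basis_at X x (range (\<lambda>n. run_at x (finite_inning n)))" by auto
qed

lemma completely_ultrametrizable: "completely_ultrametrizable_space X"
proof -
  have self: "x \<in> run_at x (finite_inning n)" if "x \<in> topspace X" for n x
    using run_at_unique[OF that, of n] by (elim conjE)
  show ?thesis
    using self run_at_agree run_at_decreasing run_at_point run_at_branch
    by (rule completely_ultrametrizable_if_tree[of X "\<lambda>n x. run_at x (finite_inning n)"])
qed

end

theorem theorem3p23:
  fixes X :: "'a topology"
  assumes "topspace X \<noteq> {}"
  shows "completely_ultrametrizable_space X \<longleftrightarrow>
    (\<exists>\<sigma>. alice_strategy X \<sigma> \<and> always_wins_at X \<sigma> omega_inning)"
proof
  assume "completely_ultrametrizable_space X"
  then obtain M d where M: "Metric_space M d"
      "\<forall>x\<in>M. \<forall>y\<in>M. \<forall>z\<in>M. d x y \<le> max (d x z) (d z y)"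
      "Metric_space.mcomplete M d" and X: "X = Metric_space.mtopology M d"
    unfolding completely_ultrametrizable_space_def by (elim exE conjE)
  interpret complete_ultrametric M d
    using M by (intro complete_ultrametric.intro complete_ultrametric_axioms.intro) auto
  show "\<exists>\<sigma>. alice_strategy X \<sigma> \<and> always_wins_at X \<sigma> omega_inning"
    using ball_strategy_wins X by blast
next
  assume "\<exists>\<sigma>. alice_strategy X \<sigma> \<and> always_wins_at X \<sigma> omega_inning"
  then obtain \<sigma> where "winning_strategy X \<sigma>"
    using assms winning_strategy_def by blast
  then show "completely_ultrametrizable_space X"
    by (rule winning_strategy.completely_ultrametrizable)
qed

end
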